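(* Let $f_1,\dots,f_s$ be nonzero elements of $\mathbf F=\mathbb K[\![x_1,\dots,x_n]\!]$ and $\mathbf A=\mathbb K[\![f_1,\dots,f_s]\!]$. If $\mathrm{rank}_{\mathbb K}\,\mathbf F/\mathrm M(\mathbf A,a_0)<+\infty$ for some $a_0\in U^n$, then $\mathrm{rank}_{\mathbb K}\,\mathbf F/\mathrm M(\mathbf A,a)<+\infty$ for all $a\in U^n$. In particular, $\mathrm{exp}(\mathbf A,a)$ is finitely generated for all $a\in U^n$.
   Context: $\mathbb K$ is a field, $n\ge 1$, $\underline x=(x_1,\dots,x_n)$, $\mathbf F=\mathbb K[\![x_1,\dots,x_n]\!]$, $U=\mathbb R_{>0}$. Fix a total well ordering $\prec$ on $\mathbb N^n$ compatible with sums. For $a\in U^n$ and a nonzero $f=\sum c_\alpha\underline x^\alpha\in\mathbf F$: $\mathrm{Supp}(f)=\{\alpha\mid c_\alpha\ne0\}$; $\nu(f,a)=\min\{a\cdot\alpha\mid\alpha\in\mathrm{Supp}(f)\}$; $\mathrm{in}(f,a)=\sum_{\alpha\in\mathrm{Supp}(f),\,a\cdot\alpha=\nu(f,a)}c_\alpha\underline x^\alpha$; $\mathrm{exp}(f,a)=\max_\prec\mathrm{Supp}(\mathrm{in}(f,a))$; $\mathrm M(f,a)=c_{\mathrm{exp}(f,a)}\underline x^{\mathrm{exp}(f,a)}$. For $S\subseteq\mathbf F$, $\mathbb K[\![S]\!]$ is the closure, in the $(x_1,\dots,x_n)$-adic topology, of the $\mathbb K$-subalgebra of $\mathbf F$ generated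 by $S$ (for a finite set of series without constant term it is the set of all formal power series in them). $\mathrm M(\mathbf A,a)=\mathbb K[\![\mathrm M(f,a), f\in\mathbf A\setminus\{0\}]\!]$ and $\mathrm{exp}(\mathbf A,a)=\{\mathrm{exp}(f,a)\mid f\in\mathbf A\setminus\{0\}\}$, a subsemigroup of $\mathbb N^n$ containing $0$. $\mathrm{rank}_{\mathbb K}$ denotes dimension as a $\mathbb K$-vector space. *)

theory Defs
  imports "HOL-Analysis.Analysis" "HOL-Library.Extended_Nat"
begin

section \<open>Formal power series in finitely many variables\<close>

text \<open>
  The variables are indexed by the finite type \<open>'n\<close>, so the number of variables is \<open>CARD('n) \<ge> 1\<close>;
  exponents are elements of \<open>nat ^ 'n\<close>.
\<close>

typedef (overloaded) ('k, 'n) mps = "UNIV :: ((nat ^ 'n::finite) \<Rightarrow> 'k) set"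
  morphisms mcoeff Mps ..

setup_lifting type_definition_mps

lemma mps_eqI: "(\<And>\<alpha>. mcoeff f \<alpha> = mcoeff g \<alpha>) \<Longrightarrow> f = g"
  by (simp add: mcoeff_inject[symmetric] fun_eq_iff)

lemma finite_antidiagonal: "finite {(\<alpha>, \<beta>). \<alpha> + \<beta> = (\<gamma> :: nat ^ 'n)}"
proof -
  have fin: "finite {\<alpha> :: nat ^ 'n. \<forall>i. \<alpha> $ i \<le> \<gamma> $ i}"
  proof -
    have "finite (Pi\<^sub>E UNIV (\<lambda>i. {..\<gamma> $ i}))" by (intro finite_PiE) auto
    moreover have "{\<alpha> :: nat ^ 'n. \<forall>i. \<alpha> $ i \<le> \<gamma> $ i} \<subseteq> vec_lambda ` Pi\<^sub>E UNIV (\<lambda>i. {..\<gamma> $ i})"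
    proof
      fix \<alpha> :: "nat ^ 'n" assume "\<alpha> \<in> {\<alpha>. \<forall>i. \<alpha> $ i \<le> \<gamma> $ i}"
      then have "vec_nth \<alpha> \<in> Pi\<^sub>E UNIV (\<lambda>i. {..\<gamma> $ i})" by auto
      then show "\<alpha> \<in> vec_lambda ` Pi\<^sub>E UNIV (\<lambda>i. {..\<gamma> $ i})"
        by (metis image_eqI vec_nth_inverse)
    qed
    ultimately show ?thesis by (meson finite_surj)
  qed
  have "{(\<alpha>, \<beta>). \<alpha> + \<beta> = \<gamma>} \<subseteq> {\<alpha>. \<forall>i. \<alpha> $ i \<le> \<gamma> $ i} \<times> {\<alpha>. \<forall>i. \<alpha> $ i \<le> \<gamma> $ i}"
    by auto
  then show ?thesis by (rule finite_subset) (intro finite_cartesian_product fin)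
qed

instantiation mps :: (comm_ring_1, finite) comm_ring_1
begin

lift_definition zero_mps :: "('a, 'b) mps" is "\<lambda>_. 0" .
lift_definition one_mps :: "('a, 'b) mps" is "\<lambda>\<alpha>. if \<alpha> = 0 then 1 else 0" .
lift_definition plus_mps :: "('a, 'b) mps \<Rightarrow> ('a, 'b) mps \<Rightarrow> ('a, 'b) mps" is "\<lambda>f g \<alpha>. f \<alpha> + g \<alpha>" .
lift_definition minus_mps :: "('a, 'b) mps \<Rightarrow> ('a, 'b) mps \<Rightarrow> ('a, 'b) mps" is "\<lambda>f g \<alpha>. f \<alpha> - g \<alpha>" .
lift_definition uminus_mps :: "('a, 'b) mps \<Rightarrow> ('a, 'b) mps" is "\<lambda>f \<alpha>. - f \<alpha>" .
lift_definition times_mps :: "('a, 'b) mps \<Rightarrow> ('a, 'b) mps \<Rightarrow> ('a, 'b) mps" is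
  "\<lambda>f g \<gamma>. \<Sum>(\<alpha>, \<beta>) | \<alpha> + \<beta> = \<gamma>. f \<alpha> * g \<beta>" .

instance
proof
  fix f g h :: "('a, 'b) mps"
  show "f * g * h = f * (g * h)"
  proof (rule mps_eqI)
    fix \<gamma>
    have "mcoeff (f * g * h) \<gamma> =
        (\<Sum>p | fst p + snd p = \<gamma>. \<Sum>q | fst q + snd q = fst p.
          mcoeff f (fst q) * mcoeff g (snd q) * mcoeff h (snd p))"
      by (simp add: times_mps.rep_eq case_prod_unfold sum_distrib_right)
    also have "\<dots> = (\<Sum>(p, q) \<in> (SIGMA p : {p. fst p + snd p = \<gamma>}. {q. fst q + snd q = fst p}).
          mcoeff f (fst q) * mcoeff g (snd q) * mcoeff h (snd p))"
      using finite_antidiagonal by (subst sum.Sigma) (auto simp: case_prod_unfold)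
    also have "\<dots> = (\<Sum>(p, q) \<in> (SIGMA p : {p. fst p + snd p = \<gamma>}. {q. fst q + snd q = snd p}).
          mcoeff f (fst p) * (mcoeff g (fst q) * mcoeff h (snd q)))"
      by (rule sum.reindex_bij_witness[of _
            "\<lambda>(p, q). ((fst p + fst q, snd q), (fst p, fst q))"
            "\<lambda>(p, q). ((fst q, snd q + snd p), (snd q, snd p))"])
        (auto simp: algebra_simps)
    also have "\<dots> = (\<Sum>p | fst p + snd p = \<gamma>. \<Sum>q | fst q + snd q = snd p.
          mcoeff f (fst p) * (mcoeff g (fst q) * mcoeff h (snd q)))"
      using finite_antidiagonal by (subst sum.Sigma) (auto simp: case_prod_unfold)
    also have "\<dots> = mcoeff (f * (g * h)) \<gamma>"
      by (simp add: times_mps.rep_eq case_prod_unfold sum_distrib_left)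
    finally show "mcoeff (f * g * h) \<gamma> = mcoeff (f * (g * h)) \<gamma>" .
  qed
  show "f * g = g * f"
  proof (rule mps_eqI)
    fix \<gamma>
    show "mcoeff (f * g) \<gamma> = mcoeff (g * f) \<gamma>"
      unfolding times_mps.rep_eq
      by (rule sum.reindex_bij_witness[of _ prod.swap prod.swap]) (auto simp: algebra_simps)
  qed
  show "1 * f = f"
  proof (rule mps_eqI)
    fix \<gamma>
    have "mcoeff (1 * f) \<gamma> = (\<Sum>(\<alpha>, \<beta>) | \<alpha> + \<beta> = \<gamma>. (if \<alpha> = 0 then 1 else 0) * mcoeff f \<beta>)"
      by (simp add: times_mps.rep_eq one_mps.rep_eq)
    also have "\<dots> = (\<Sum>(\<alpha>, \<beta>) \<in> {(0 :: nat ^ 'b, \<gamma>)}. (if \<alpha> = 0 then 1 else 0) * mcoeff f \<beta>)"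
      by (rule sum.mono_neutral_right) (auto simp: finite_antidiagonal split: if_splits)
    finally show "mcoeff (1 * f) \<gamma> = mcoeff f \<gamma>" by simp
  qed
  show "(f + g) * h = f * h + g * h"
    by (rule mps_eqI)
      (simp add: times_mps.rep_eq plus_mps.rep_eq case_prod_unfold distrib_right sum.distrib)
  show "(0 :: ('a, 'b) mps) \<noteq> 1"
  proof
    assume "(0 :: ('a, 'b) mps) = 1"
    then have "mcoeff (0 :: ('a, 'b) mps) 0 = mcoeff 1 0" by simp
    then show False by (simp add: zero_mps.rep_eq one_mps.rep_eq)
  qed
qed (auto intro!: mps_eqI simp: zero_mps.rep_eq plus_mps.rep_eq minus_mps.rep_eq
    uminus_mps.rep_eq algebra_simps)

end

lift_definition mscale :: "'k::comm_ring_1 \<Rightarrow> ('k, 'n::finite) mps \<Rightarrow> ('k, 'n) mps" is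
  "\<lambda>c f \<alpha>. c * f \<alpha>" .

lift_definition mmonom :: "'k::comm_ring_1 \<Rightarrow> nat ^ 'n \<Rightarrow> ('k, 'n::finite) mps" is
  "\<lambda>c \<alpha> \<beta>. if \<beta> = \<alpha> then c else 0" .

definition mvar :: "'n \<Rightarrow> ('k::comm_ring_1, 'n::finite) mps" where
  "mvar i = mmonom 1 (axis i 1)"

lemma vector_space_mscale: "vector_space (mscale :: 'k::field \<Rightarrow> ('k, 'n::finite) mps \<Rightarrow> _)"
  by unfold_locales
    (auto intro!: mps_eqI simp: mscale.rep_eq plus_mps.rep_eq algebra_simps)

section \<open>The adic topology of the maximal ideal of the variables\<close>

definition mps_ideal :: "('k::comm_ring_1, 'n::finite) mps set \<Rightarrow> bool" where
  "mps_ideal I \<longleftrightarrow> 0 \<in> I \<and> (\<forall>f\<in>I. \<forall>g\<in>I. f + g \<in> I) \<and> (\<forall>h. \<forall>f\<in>I. h * f \<in> I)"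

primrec var_ideal_pow :: "nat \<Rightarrow> ('k::comm_ring_1, 'n::finite) mps set" where
  "var_ideal_pow 0 = UNIV"
| "var_ideal_pow (Suc N) = mps_ideal hull {mvar i * g | i g. g \<in> var_ideal_pow N}"

lemma mps_ideal_hull: "mps_ideal (mps_ideal hull S)"
  by (rule hull_in) (auto simp: mps_ideal_def)

lemma mps_ideal_var_ideal_pow: "mps_ideal (var_ideal_pow N)"
  by (cases N) (simp_all add: mps_ideal_hull, simp add: mps_ideal_def)

lemma var_ideal_pow_antimono: "M \<le> N \<Longrightarrow> var_ideal_pow N \<subseteq> var_ideal_pow M"
proof (rule lift_Suc_antimono_le)
  fix N
  show "var_ideal_pow (Suc N) \<subseteq> var_ideal_pow N"
    unfolding var_ideal_pow.simps using mps_ideal_var_ideal_pow[of N]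
    by (intro hull_minimal) (auto simp: mps_ideal_def)
qed

lemma mcoeff_mvar_mult:
  fixes f :: "('k::comm_ring_1, 'n::finite) mps"
  shows "mcoeff (mvar i * f) \<gamma> = (if \<gamma> $ i = 0 then 0 else mcoeff f (\<gamma> - axis i 1))"
proof -
  have *: "mcoeff (mvar i * f) \<gamma> =
      (\<Sum>(\<alpha>, \<beta>) | \<alpha> + \<beta> = \<gamma>. (if \<alpha> = axis i 1 then 1 else 0) * mcoeff f \<beta>)"
    by (simp add: times_mps.rep_eq mvar_def mmonom.rep_eq)
  show ?thesis
  proof (cases "\<gamma> $ i = 0")
    case True
    then show ?thesis unfolding *
      by (auto intro!: sum.neutral simp: axis_def)
  next
    case False
    then have "axis i 1 + (\<gamma> - axis i 1) = \<gamma>"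
      by (auto simp: vec_eq_iff axis_def)
    then have "(\<Sum>(\<alpha>, \<beta>) | \<alpha> + \<beta> = \<gamma>. (if \<alpha> = axis i 1 then 1 else 0) * mcoeff f \<beta>) =
      (\<Sum>(\<alpha>, \<beta>) \<in> {(axis i 1 :: nat ^ 'n, \<gamma> - axis i 1)}. (if \<alpha> = axis i 1 then 1 else 0) * mcoeff f \<beta>)"
      by (intro sum.mono_neutral_right) (auto simp: finite_antidiagonal split: if_splits)
    with False show ?thesis unfolding * by simp
  qed
qed

lemma mcoeff_sum: "mcoeff (\<Sum>x\<in>X. g x) \<alpha> = (\<Sum>x\<in>X. mcoeff (g x) \<alpha>)"
  by (induction X rule: infinite_finite_induct) (auto simp: zero_mps.rep_eq plus_mps.rep_eq)

lemma mem_var_ideal_pow_iff: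
  "f \<in> var_ideal_pow N \<longleftrightarrow> (\<forall>\<alpha>. (\<Sum>i\<in>UNIV. \<alpha> $ i) < N \<longrightarrow> mcoeff f \<alpha> = 0)"
proof (induction N arbitrary: f)
  case 0
  show ?case by simp
next
  case (Suc N)
  define J :: "('a, 'b) mps set"
    where "J = {f. \<forall>\<alpha>. (\<Sum>i\<in>UNIV. \<alpha> $ i) < Suc N \<longrightarrow> mcoeff f \<alpha> = 0}"
  have "var_ideal_pow (Suc N) \<subseteq> J"
    unfolding var_ideal_pow.simps
  proof (rule hull_minimal)
    show "mps_ideal J" unfolding mps_ideal_def
    proof (intro conjI allI ballI)
      fix h f :: "('a, 'b) mps" assume f: "f \<in> J"
      have "mcoeff (h * f) \<gamma> = 0" if "(\<Sum>i\<in>UNIV. \<gamma> $ i) < Suc N" for \<gamma>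
        using that f unfolding times_mps.rep_eq
        by (auto intro!: sum.neutral simp: J_def sum.distrib)
      then show "h * f \<in> J" by (simp add: J_def)
    qed (auto simp: J_def zero_mps.rep_eq plus_mps.rep_eq)
    show "{mvar i * g |i g. g \<in> var_ideal_pow N} \<subseteq> J"
    proof safe
      fix i and g :: "('a, 'b) mps" assume g: "g \<in> var_ideal_pow N"
      have "mcoeff (mvar i * g) \<gamma> = 0" if "(\<Sum>j\<in>UNIV. \<gamma> $ j) < Suc N" for \<gamma>
      proof (cases "\<gamma> $ i = 0")
        case False
        then have "axis i 1 + (\<gamma> - axis i 1) = \<gamma>" by (auto simp: vec_eq_iff axis_def)
        then have "(\<Sum>j\<in>UNIV. \<gamma> $ j) = (\<Sum>j\<in>UNIV. (axis i 1 + (\<gamma> - axis i 1)) $ j)" by simp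
        also have "\<dots> = Suc (\<Sum>j\<in>UNIV. (\<gamma> - axis i 1) $ j)"
          by (simp add: sum.distrib axis_def del: vector_minus_component)
        finally show ?thesis using that g False by (auto simp: mcoeff_mvar_mult Suc.IH)
      qed (simp add: mcoeff_mvar_mult)
      then show "mvar i * g \<in> J" by (simp add: J_def)
    qed
  qed
  moreover have "f \<in> var_ideal_pow (Suc N)" if f: "f \<in> J" for f :: "('a, 'b) mps"
  proof -
    define p where "p = (\<lambda>\<beta> :: nat ^ 'b. SOME i. \<beta> $ i \<noteq> 0)"
    have p: "\<beta> $ p \<beta> \<noteq> 0" if "\<beta> \<noteq> 0" for \<beta>
    proof -
      from that have "\<exists>i. \<beta> $ i \<noteq> 0" by (auto simp: vec_eq_iff)
      then show ?thesis unfolding p_def by (rule someI_ex)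
    qed
    define g where "g = (\<lambda>i. Mps (\<lambda>\<beta>. if p (\<beta> + axis i 1) = i then mcoeff f (\<beta> + axis i 1) else 0))"
    have g: "mcoeff (g i) \<beta> = (if p (\<beta> + axis i 1) = i then mcoeff f (\<beta> + axis i 1) else 0)" for i \<beta>
      by (simp add: g_def Mps_inverse)
    have "g i \<in> var_ideal_pow N" for i
      using f unfolding Suc.IH g by (auto simp: J_def sum.distrib axis_def)
    then have in_I: "mvar i * g i \<in> var_ideal_pow (Suc N)" for i
      unfolding var_ideal_pow.simps by (intro hull_inc) auto
    have "f = (\<Sum>i\<in>UNIV. mvar i * g i)"
    proof (rule mps_eqI)
      fix \<beta>
      have "mcoeff (mvar i * g i) \<beta> = (if i = p \<beta> then mcoeff f \<beta> else 0)" for i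
      proof (cases "\<beta> $ i = 0")
        case True
        moreover have "mcoeff f 0 = 0" using f by (auto simp: J_def)
        ultimately show ?thesis using p[of \<beta>]
          by (cases "\<beta> = 0") (auto simp: mcoeff_mvar_mult)
      next
        case False
        then have "\<beta> - axis i 1 + axis i 1 = \<beta>" by (auto simp: vec_eq_iff axis_def)
        then show ?thesis using False by (auto simp: mcoeff_mvar_mult g)
      qed
      then show "mcoeff f \<beta> = mcoeff (\<Sum>i\<in>UNIV. mvar i * g i) \<beta>" by (simp add: mcoeff_sum)
    qed
    moreover have "(\<Sum>i\<in>X. mvar i * g i) \<in> var_ideal_pow (Suc N)" for X
      using in_I mps_ideal_var_ideal_pow[of "Suc N"]
      by (induction X rule: infinite_finite_induct) (auto simp: mps_ideal_def)
    ultimately show ?thesis by metis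
  qed
  ultimately show ?case unfolding J_def by blast
qed

instantiation mps :: (comm_ring_1, finite) topological_space
begin

definition open_mps :: "('a, 'b) mps set \<Rightarrow> bool" where
  "open_mps U \<longleftrightarrow> (\<forall>f\<in>U. \<exists>N. \<forall>g. g - f \<in> var_ideal_pow N \<longrightarrow> g \<in> U)"

instance
proof
  show "open (UNIV :: ('a, 'b) mps set)" by (simp add: open_mps_def)
next
  fix S T :: "('a, 'b) mps set"
  assume S: "open S" and T: "open T"
  show "open (S \<inter> T)" unfolding open_mps_def
  proof
    fix f assume "f \<in> S \<inter> T"
    with S T obtain M N where
      "\<forall>g. g - f \<in> var_ideal_pow M \<longrightarrow> g \<in> S" "\<forall>g. g - f \<in> var_ideal_pow N \<longrightarrow> g \<in> T"
      unfolding open_mps_def by blast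
    moreover have "var_ideal_pow (max M N) \<subseteq> (var_ideal_pow M :: ('a, 'b) mps set)"
      "var_ideal_pow (max M N) \<subseteq> (var_ideal_pow N :: ('a, 'b) mps set)"
      by (intro var_ideal_pow_antimono; simp)+
    ultimately show "\<exists>N. \<forall>g. g - f \<in> var_ideal_pow N \<longrightarrow> g \<in> S \<inter> T" by blast
  qed
next
  fix K :: "('a, 'b) mps set set"
  assume "\<forall>S\<in>K. open S"
  then show "open (\<Union>K)" unfolding open_mps_def by (meson UnionE UnionI)
qed

end

section \<open>Closed subalgebras and dimension of quotients\<close>

definition mps_subalgebra :: "('k::field, 'n::finite) mps set \<Rightarrow> bool" where
  "mps_subalgebra B \<longleftrightarrow> 1 \<in> B \<and> (\<forall>f\<in>B. \<forall>g\<in>B. f + g \<in> B \<and> f * g \<in> B) \<and> (\<forall>c. \<forall>f\<in>B. mscale c f \<in> B)"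

definition closed_subalgebra_gen :: "('k::field, 'n::finite) mps set \<Rightarrow> ('k, 'n) mps set" where
  "closed_subalgebra_gen S = closure (mps_subalgebra hull S)"

text \<open>
  For a linear subspace \<open>V\<close>, the finite set \<open>B\<close> represents a basis of the quotient of the power
  series ring by \<open>V\<close>: the classes of its elements are pairwise distinct, linearly independent, and span the quotient.
\<close>

definition quotient_basis :: "('k::field, 'n::finite) mps set \<Rightarrow> ('k, 'n) mps set \<Rightarrow> bool" where
  "quotient_basis V B \<longleftrightarrow> finite B \<and>
     (\<forall>c. (\<Sum>b\<in>B. mscale (c b) b) \<in> V \<longrightarrow> (\<forall>b\<in>B. c b = 0)) \<and>
     (\<forall>f. \<exists>c. f - (\<Sum>b\<in>B. mscale (c b) b) \<in> V)"

text \<open>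
  All finite bases have the same cardinality, so the infimum is over at most one value;
  it is \<open>\<infinity>\<close> if there is no finite basis.
\<close>

definition quotient_rank :: "('k::field, 'n::finite) mps set \<Rightarrow> enat" where
  "quotient_rank V = Inf {enat (card B) | B. quotient_basis V B}"

section \<open>Initial forms with respect to weights\<close>

definition compatible_well_order :: "(nat ^ 'n::finite) rel \<Rightarrow> bool" where
  "compatible_well_order r \<longleftrightarrow>
     well_order r \<and> (\<forall>\<alpha> \<beta> \<gamma>. (\<alpha>, \<beta>) \<in> r \<longrightarrow> (\<alpha> + \<gamma>, \<beta> + \<gamma>) \<in> r)"

definition weights :: "(real ^ 'n::finite) set" where
  "weights = {a. \<forall>i. 0 < a $ i}"

definition wdeg :: "real ^ 'n \<Rightarrow> nat ^ 'n::finite \<Rightarrow> real" where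
  "wdeg a \<alpha> = (\<Sum>i\<in>UNIV. a $ i * real (\<alpha> $ i))"

definition Supp :: "('k::field, 'n::finite) mps \<Rightarrow> (nat ^ 'n) set" where
  "Supp f = {\<alpha>. mcoeff f \<alpha> \<noteq> 0}"

text \<open>The minimum exists for \<open>f \<noteq> 0\<close> and positive \<open>a\<close>, since then only finitely many exponents have
  weighted degree below a given bound.\<close>

definition ord_wt :: "('k::field, 'n::finite) mps \<Rightarrow> real ^ 'n \<Rightarrow> real" where
  "ord_wt f a = (LEAST d. d \<in> wdeg a ` Supp f)"

definition init_form :: "('k::field, 'n::finite) mps \<Rightarrow> real ^ 'n \<Rightarrow> ('k, 'n) mps" where
  "init_form f a = Mps (\<lambda>\<alpha>. if \<alpha> \<in> Supp f \<and> wdeg a \<alpha> = ord_wt f a then mcoeff f \<alpha> else 0)"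

definition lead_exp :: "(nat ^ 'n) rel \<Rightarrow> ('k::field, 'n::finite) mps \<Rightarrow> real ^ 'n \<Rightarrow> nat ^ 'n" where
  "lead_exp r f a = (THE \<alpha>. \<alpha> \<in> Supp (init_form f a) \<and> (\<forall>\<beta> \<in> Supp (init_form f a). (\<beta>, \<alpha>) \<in> r))"

definition lead_monom :: "(nat ^ 'n) rel \<Rightarrow> ('k::field, 'n::finite) mps \<Rightarrow> real ^ 'n \<Rightarrow> ('k, 'n) mps" where
  "lead_monom r f a = mmonom (mcoeff f (lead_exp r f a)) (lead_exp r f a)"

definition lead_alg :: "(nat ^ 'n) rel \<Rightarrow> ('k::field, 'n::finite) mps set \<Rightarrow> real ^ 'n \<Rightarrow> ('k, 'n) mps set" where
  "lead_alg r A a = closed_subalgebra_gen {lead_monom r f a | f. f \<in> A - {0}}"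

definition exp_set :: "(nat ^ 'n) rel \<Rightarrow> ('k::field, 'n::finite) mps set \<Rightarrow> real ^ 'n \<Rightarrow> (nat ^ 'n) set" where
  "exp_set r A a = {lead_exp r f a | f. f \<in> A - {0}}"

definition submonoid :: "(nat ^ 'n::finite) set \<Rightarrow> bool" where
  "submonoid H \<longleftrightarrow> 0 \<in> H \<and> (\<forall>\<alpha>\<in>H. \<forall>\<beta>\<in>H. \<alpha> + \<beta> \<in> H)"

definition finitely_generated :: "(nat ^ 'n::finite) set \<Rightarrow> bool" where
  "finitely_generated H \<longleftrightarrow> (\<exists>G. finite G \<and> H = submonoid hull G)"

end

theory Submission
  imports Defs
begin

text \<open>
  The idea is that the number of exponents missing from \<open>exp(A, a)\<close> is the codimension of
  \<open>A\<close> in the ring of power series, a number in which \<open>a\<close> does not occur.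

  Fix a positive weight \<open>a\<close> and order the exponents by weighted degree first and, within one
  degree, by the reverse of the given well-ordering. Only finitely many exponents lie below a given
  one, and \<open>exp(f, a)\<close> is the least exponent of \<open>f\<close> in this order. For any linear subspace \<open>V\<close>,
  let \<open>E\<close> be the set of leading exponents of its nonzero elements.
  A nonzero series supported outside \<open>E\<close> is not in \<open>V\<close>, so the monomials outside \<open>E\<close> are
  independent modulo \<open>V\<close>; if \<open>V\<close> has finite codimension, then \<open>E\<close> is cofinite
  (\<open>finite_of_independent_modulo\<close>). If \<open>V\<close> is closed, every series can be divided by \<open>V\<close> with
  a remainder supported outside \<open>E\<close> (\<open>division_by_closed_subspace\<close>): this is a triangular
  system of equations, solved along the order, whose infinite sum of multiples of elements of \<open>V\<close>
  converges in \<open>V\<close>. So \<open>E\<close> being cofinite forces \<open>V\<close> to have finite codimension.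

  Applied to \<open>V = A\<close>, this carries cofiniteness of \<open>exp(A, a\<^sub>0)\<close> over to \<open>exp(A, a)\<close>. It
  remains to compare \<open>exp(A, a)\<close> with \<open>M(A, a)\<close>. As \<open>exp(A, a)\<close> is a monoid, \<open>M(A, a)\<close>
  consists of all series with support in \<open>exp(A, a)\<close> (\<open>lead_alg_eq\<close>), so that it has finite
  codimension exactly when \<open>exp(A, a)\<close> is cofinite. Finally, a cofinite submonoid of
  \<open>\<nat>\<^sup>n\<close> is finitely generated, since every element of large total degree splits into two
  smaller ones that still have large degree (\<open>cofinite_submonoid_finitely_generated\<close>).
\<close>

section \<open>Exponents of bounded degree\<close>

abbreviation total_degree :: "nat ^ 'n::finite \<Rightarrow> nat" where
  "total_degree \<alpha> \<equiv> \<Sum>i\<in>UNIV. \<alpha> $ i"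

lemma total_degree_add: "total_degree (\<alpha> + \<beta>) = total_degree \<alpha> + total_degree \<beta>"
  by (simp add: sum.distrib)

lemma finite_exponents_below:
  fixes b :: "'n::finite \<Rightarrow> nat"
  shows "finite {\<alpha> :: nat ^ 'n. \<forall>i. \<alpha> $ i \<le> b i}"
proof (rule finite_subset)
  show "{\<alpha> :: nat ^ 'n. \<forall>i. \<alpha> $ i \<le> b i} \<subseteq> fst ` {(\<alpha>, \<beta>). \<alpha> + \<beta> = vec_lambda b}"
  proof
    fix \<alpha> :: "nat ^ 'n"
    assume "\<alpha> \<in> {\<alpha>. \<forall>i. \<alpha> $ i \<le> b i}"
    then have "\<alpha> + (\<chi> i. b i - \<alpha> $ i) = vec_lambda b"
      by (simp add: vec_eq_iff)
    then have "(\<alpha>, \<chi> i. b i - \<alpha> $ i) \<in> {(\<alpha>, \<beta>). \<alpha> + \<beta> = vec_lambda b}"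
      by simp
    then show "\<alpha> \<in> fst ` {(\<alpha>, \<beta>). \<alpha> + \<beta> = vec_lambda b}"
      by force
  qed
qed (intro finite_imageI finite_antidiagonal)

lemma finite_total_degree_le: "finite {\<alpha> :: nat ^ 'n::finite. total_degree \<alpha> \<le> N}"
proof (rule finite_subset)
  show "{\<alpha> :: nat ^ 'n. total_degree \<alpha> \<le> N} \<subseteq> {\<alpha>. \<forall>i. \<alpha> $ i \<le> N}"
  proof safe
    fix \<alpha> :: "nat ^ 'n" and i
    assume "total_degree \<alpha> \<le> N"
    moreover have "\<alpha> $ i \<le> total_degree \<alpha>"
      by (rule member_le_sum) auto
    ultimately show "\<alpha> $ i \<le> N" by simp
  qed
qed (rule finite_exponents_below)

lemma finite_wdeg_le:
  fixes a :: "real ^ 'n::finite"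
  assumes "a \<in> weights"
  shows "finite {\<alpha>. wdeg a \<alpha> \<le> d}"
proof (rule finite_subset)
  show "{\<alpha>. wdeg a \<alpha> \<le> d} \<subseteq> {\<alpha>. \<forall>i. \<alpha> $ i \<le> nat \<lfloor>d / a $ i\<rfloor>}"
  proof safe
    fix \<alpha> :: "nat ^ 'n" and i
    assume "wdeg a \<alpha> \<le> d"
    have pos: "0 < a $ j" for j using assms by (simp add: weights_def)
    have "a $ i * real (\<alpha> $ i) \<le> wdeg a \<alpha>"
      unfolding wdeg_def by (rule member_le_sum) (auto intro!: mult_nonneg_nonneg less_imp_le[OF pos])
    with \<open>wdeg a \<alpha> \<le> d\<close> have "real (\<alpha> $ i) \<le> d / a $ i"
      using pos[of i] by (simp add: field_simps)
    then show "\<alpha> $ i \<le> nat \<lfloor>d / a $ i\<rfloor>"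
      by (simp add: le_nat_floor)
  qed
qed (rule finite_exponents_below)

lemma wdeg_add: "wdeg a (\<alpha> + \<beta>) = wdeg a \<alpha> + wdeg a \<beta>"
  by (simp add: wdeg_def sum.distrib algebra_simps)

section \<open>Cofinite submonoids\<close>

lemma exists_exponent_part:
  fixes \<alpha> :: "nat ^ 'n::finite"
  assumes "m \<le> total_degree \<alpha>"
  shows "\<exists>\<beta> \<gamma>. \<alpha> = \<beta> + \<gamma> \<and> total_degree \<beta> = m"
  using assms
proof (induction m)
  case 0
  show ?case by (intro exI[of _ 0] exI[of _ \<alpha>]) simp
next
  case (Suc m)
  then obtain \<beta> \<gamma> where \<beta>\<gamma>: "\<alpha> = \<beta> + \<gamma>" "total_degree \<beta> = m" by auto
  have "total_degree \<gamma> \<noteq> 0"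
    using Suc.prems unfolding \<beta>\<gamma>(1) total_degree_add \<beta>\<gamma>(2) by linarith
  then obtain i where i: "\<gamma> $ i \<noteq> 0" by (meson sum.neutral)
  have "\<alpha> = (\<beta> + axis i 1) + (\<gamma> - axis i 1)"
    using i unfolding \<beta>\<gamma>(1) by (auto simp: vec_eq_iff axis_def)
  moreover have "total_degree (\<beta> + axis i 1) = Suc m"
    using \<beta>\<gamma>(2) by (simp add: sum.distrib axis_def)
  ultimately show ?case by blast
qed

text \<open>
  If every exponent of total degree at least \<open>N > 0\<close> belongs to the monoid, an element of degree
  more than \<open>2 N\<close> is the sum of an exponent of degree exactly \<open>N\<close> and one of degree more than
  \<open>N\<close>, and both of these lie in the monoid. So the elements of degree at most \<open>2 N\<close> generate.
\<close>

lemma cofinite_submonoid_finitely_generated: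
  fixes H :: "(nat ^ 'n::finite) set"
  assumes H: "submonoid H" and fin: "finite (- H)"
  shows "finitely_generated H"
proof -
  define N where "N = Suc (\<Sum>\<alpha>\<in>- H. total_degree \<alpha>)"
  have large: "\<alpha> \<in> H" if "N \<le> total_degree \<alpha>" for \<alpha>
  proof (rule ccontr)
    assume "\<alpha> \<notin> H"
    then have "total_degree \<alpha> \<le> (\<Sum>\<alpha>\<in>- H. total_degree \<alpha>)"
      by (intro member_le_sum[of \<alpha> "- H" total_degree] fin) auto
    with that show False by (simp add: N_def)
  qed
  define G where "G = {\<alpha> \<in> H. total_degree \<alpha> \<le> 2 * N}"
  have "finite G"
    unfolding G_def by (rule finite_subset[OF _ finite_total_degree_le]) auto
  have gen: "\<alpha> \<in> submonoid hull G" if "\<alpha> \<in> H" for \<alpha>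
    using that
  proof (induction "total_degree \<alpha>" arbitrary: \<alpha> rule: less_induct)
    case less
    show ?case
    proof (cases "total_degree \<alpha> \<le> 2 * N")
      case True
      with less.prems show ?thesis by (intro hull_inc) (simp add: G_def)
    next
      case False
      obtain \<beta> \<gamma> where \<beta>\<gamma>: "\<alpha> = \<beta> + \<gamma>" "total_degree \<beta> = N"
        using exists_exponent_part[of N \<alpha>] False by auto
      have deg: "total_degree \<alpha> = N + total_degree \<gamma>"
        by (simp only: \<beta>\<gamma> total_degree_add)
      have "\<beta> \<in> submonoid hull G"
        using \<beta>\<gamma>(2) deg False large[of \<beta>] by (intro less.hyps) auto
      moreover have "\<gamma> \<in> submonoid hull G"
        using deg False large[of \<gamma>] by (intro less.hyps) (auto simp: N_def)
      moreover have "submonoid (submonoid hull G)"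
        by (rule hull_in) (auto simp: submonoid_def)
      ultimately show ?thesis unfolding \<beta>\<gamma>(1) by (simp add: submonoid_def)
    qed
  qed
  have "submonoid hull G \<subseteq> H"
    by (rule hull_minimal) (use H in \<open>auto simp: G_def\<close>)
  with gen have "H = submonoid hull G" by blast
  with \<open>finite G\<close> show ?thesis unfolding finitely_generated_def by blast
qed

section \<open>Power series as a vector space and closed subalgebras\<close>

interpretation mps: vector_space "mscale :: 'k::field \<Rightarrow> ('k, 'n::finite) mps \<Rightarrow> _"
  by (rule vector_space_mscale)

lemmas mcoeff_simps = zero_mps.rep_eq one_mps.rep_eq plus_mps.rep_eq minus_mps.rep_eq
  uminus_mps.rep_eq mscale.rep_eq mmonom.rep_eq mcoeff_sum Mps_inverse

lemma mcoeff_sum_monomials: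
  fixes d :: "nat ^ 'n::finite \<Rightarrow> 'k::field"
  assumes "finite X"
  shows "mcoeff (\<Sum>\<alpha>\<in>X. mscale (d \<alpha>) (mmonom 1 \<alpha>)) \<beta> = (if \<beta> \<in> X then d \<beta> else 0)"
proof -
  have "mcoeff (\<Sum>\<alpha>\<in>X. mscale (d \<alpha>) (mmonom 1 \<alpha>)) \<beta> = (\<Sum>\<alpha>\<in>X. if \<beta> = \<alpha> then d \<alpha> else 0)"
    by (simp add: mcoeff_simps if_distrib cong: if_cong)
  with assms show ?thesis by simp
qed

lemma mem_closure_iff_approx:
  fixes h :: "('k::field, 'n::finite) mps"
  shows "h \<in> closure S \<longleftrightarrow>
    (\<forall>N. \<exists>g\<in>S. \<forall>\<alpha>. total_degree \<alpha> < N \<longrightarrow> mcoeff g \<alpha> = mcoeff h \<alpha>)"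
proof safe
  fix N
  assume h: "h \<in> closure S"
  define U where "U = {g. \<forall>\<alpha>. total_degree \<alpha> < N \<longrightarrow> mcoeff g \<alpha> = mcoeff h \<alpha>}"
  have "open U"
    unfolding open_mps_def
  proof
    fix u assume "u \<in> U"
    then have "\<forall>g. g - u \<in> var_ideal_pow N \<longrightarrow> g \<in> U"
      by (simp add: U_def mem_var_ideal_pow_iff mcoeff_simps)
    then show "\<exists>N. \<forall>g. g - u \<in> var_ideal_pow N \<longrightarrow> g \<in> U" ..
  qed
  moreover have "h \<in> U \<inter> closure S" using h by (simp add: U_def)
  ultimately have "U \<inter> S \<noteq> {}" using open_Int_closure_eq_empty by blast
  then show "\<exists>g\<in>S. \<forall>\<alpha>. total_degree \<alpha> < N \<longrightarrow> mcoeff g \<alpha> = mcoeff h \<alpha>"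
    unfolding U_def by blast
next
  assume approx: "\<forall>N. \<exists>g\<in>S. \<forall>\<alpha>. total_degree \<alpha> < N \<longrightarrow> mcoeff g \<alpha> = mcoeff h \<alpha>"
  show "h \<in> closure S"
  proof (rule ccontr)
    assume "h \<notin> closure S"
    moreover have "open (- closure S)" by (intro open_Compl closed_closure)
    ultimately obtain N where N: "\<And>g. g - h \<in> var_ideal_pow N \<Longrightarrow> g \<in> - closure S"
      unfolding open_mps_def by blast
    obtain g where "g \<in> S" "\<forall>\<alpha>. total_degree \<alpha> < N \<longrightarrow> mcoeff g \<alpha> = mcoeff h \<alpha>"
      using approx by blast
    then have "g \<in> - closure S"
      by (intro N) (simp add: mem_var_ideal_pow_iff mcoeff_simps)
    with \<open>g \<in> S\<close> show False using closure_subset by blast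
  qed
qed

lemma mcoeff_mult_cong:
  fixes f g f' g' :: "('k::field, 'n::finite) mps"
  assumes "\<And>\<alpha>. total_degree \<alpha> < N \<Longrightarrow> mcoeff f \<alpha> = mcoeff f' \<alpha>"
    and "\<And>\<alpha>. total_degree \<alpha> < N \<Longrightarrow> mcoeff g \<alpha> = mcoeff g' \<alpha>"
    and "total_degree \<gamma> < N"
  shows "mcoeff (f * g) \<gamma> = mcoeff (f' * g') \<gamma>"
  unfolding times_mps.rep_eq
proof (rule sum.cong, simp, clarify)
  fix \<alpha> \<beta> :: "nat ^ 'n"
  assume "\<gamma> = \<alpha> + \<beta>"
  then have "total_degree \<alpha> < N" "total_degree \<beta> < N"
    using assms(3) by (auto simp: sum.distrib)
  then show "mcoeff f \<alpha> * mcoeff g \<beta> = mcoeff f' \<alpha> * mcoeff g' \<beta>"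
    using assms(1,2) by simp
qed

lemma mps_subalgebra_closure:
  fixes B :: "('k::field, 'n::finite) mps set"
  assumes B: "mps_subalgebra B"
  shows "mps_subalgebra (closure B)"
proof -
  have prod_sum: "f + g \<in> closure B \<and> f * g \<in> closure B"
    if f: "f \<in> closure B" and g: "g \<in> closure B" for f g
    unfolding mem_closure_iff_approx
  proof (intro conjI allI)
    fix N
    obtain f' where f': "f' \<in> B" "\<And>\<alpha>. total_degree \<alpha> < N \<Longrightarrow> mcoeff f' \<alpha> = mcoeff f \<alpha>"
      using f unfolding mem_closure_iff_approx by blast
    obtain g' where g': "g' \<in> B" "\<And>\<alpha>. total_degree \<alpha> < N \<Longrightarrow> mcoeff g' \<alpha> = mcoeff g \<alpha>"
      using g unfolding mem_closure_iff_approx by blast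
    show "\<exists>h\<in>B. \<forall>\<alpha>. total_degree \<alpha> < N \<longrightarrow> mcoeff h \<alpha> = mcoeff (f + g) \<alpha>"
      using f' g' B by (intro bexI[of _ "f' + g'"]) (auto simp: mcoeff_simps mps_subalgebra_def)
    show "\<exists>h\<in>B. \<forall>\<alpha>. total_degree \<alpha> < N \<longrightarrow> mcoeff h \<alpha> = mcoeff (f * g) \<alpha>"
      using f'(1) g'(1) B mcoeff_mult_cong[of N f' f g' g, OF f'(2) g'(2)]
      by (intro bexI[of _ "f' * g'"]) (auto simp: mps_subalgebra_def)
  qed
  have scale: "mscale c f \<in> closure B" if f: "f \<in> closure B" for c f
    unfolding mem_closure_iff_approx
  proof
    fix N
    obtain f' where f': "f' \<in> B" "\<And>\<alpha>. total_degree \<alpha> < N \<Longrightarrow> mcoeff f' \<alpha> = mcoeff f \<alpha>"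
      using f unfolding mem_closure_iff_approx by blast
    then show "\<exists>h\<in>B. \<forall>\<alpha>. total_degree \<alpha> < N \<longrightarrow> mcoeff h \<alpha> = mcoeff (mscale c f) \<alpha>"
      using B by (intro bexI[of _ "mscale c f'"]) (auto simp: mcoeff_simps mps_subalgebra_def)
  qed
  have "1 \<in> closure B"
    using B closure_subset unfolding mps_subalgebra_def by blast
  with prod_sum scale show ?thesis unfolding mps_subalgebra_def by blast
qed

lemma mps_subalgebra_hull: "mps_subalgebra (mps_subalgebra hull S)"
  by (rule hull_in) (auto simp: mps_subalgebra_def)

lemma mps_subalgebra_closed_subalgebra_gen: "mps_subalgebra (closed_subalgebra_gen S)"
  unfolding closed_subalgebra_gen_def by (intro mps_subalgebra_closure mps_subalgebra_hull)

lemma subspace_of_mps_subalgebra: "mps_subalgebra B \<Longrightarrow> mps.subspace B"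
  unfolding mps.subspace_def mps_subalgebra_def
  using mps.scale_zero_left by metis

lemma Supp_mult:
  assumes "\<gamma> \<in> Supp (f * g)"
  shows "\<exists>\<alpha>\<in>Supp f. \<exists>\<beta>\<in>Supp g. \<gamma> = \<alpha> + \<beta>"
proof (rule ccontr)
  assume "\<not> ?thesis"
  then have "mcoeff (f * g) \<gamma> = 0"
    unfolding times_mps.rep_eq by (intro sum.neutral) (auto simp: Supp_def)
  with assms show False by (simp add: Supp_def)
qed

text \<open>
  The \<open>\<subseteq>\<close> part holds because the right-hand side is itself a closed subalgebra, which is where
  \<open>E\<close> being a monoid enters; for \<open>\<supseteq>\<close>, truncate a series at a high total degree.
\<close>

lemma closed_subalgebra_gen_monomials:
  fixes E :: "(nat ^ 'n::finite) set" and S :: "('k::field, 'n) mps set"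
  assumes E: "submonoid E"
    and S_supp: "\<And>g. g \<in> S \<Longrightarrow> Supp g \<subseteq> E"
    and S_mono: "\<And>\<alpha>. \<alpha> \<in> E \<Longrightarrow> \<exists>c. c \<noteq> 0 \<and> mmonom c \<alpha> \<in> S"
  shows "closed_subalgebra_gen S = {g. Supp g \<subseteq> E}"
proof
  let ?T = "{g :: ('k, 'n) mps. Supp g \<subseteq> E}"
  have "mps_subalgebra ?T"
    unfolding mps_subalgebra_def
  proof (intro conjI ballI allI)
    show "1 \<in> ?T"
      using E by (auto simp: Supp_def submonoid_def mcoeff_simps)
  next
    fix f g assume fg: "f \<in> ?T" "g \<in> ?T"
    show "f + g \<in> ?T"
    proof
      show "Supp (f + g) \<subseteq> E"
      proof
        fix \<alpha> assume "\<alpha> \<in> Supp (f + g)"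
        then have "\<alpha> \<in> Supp f \<or> \<alpha> \<in> Supp g" by (auto simp: Supp_def mcoeff_simps)
        with fg show "\<alpha> \<in> E" by blast
      qed
    qed
    show "f * g \<in> ?T"
    proof
      show "Supp (f * g) \<subseteq> E"
      proof
        fix \<gamma> assume "\<gamma> \<in> Supp (f * g)"
        then obtain \<alpha> \<beta> where "\<alpha> \<in> Supp f" "\<beta> \<in> Supp g" "\<gamma> = \<alpha> + \<beta>"
          using Supp_mult by blast
        with fg E show "\<gamma> \<in> E" unfolding submonoid_def by blast
      qed
    qed
  next
    fix c and f :: "('k, 'n) mps" assume "f \<in> ?T"
    then show "mscale c f \<in> ?T" by (auto simp: Supp_def mcoeff_simps)
  qed
  then have hull_sub: "mps_subalgebra hull S \<subseteq> ?T"
    using S_supp by (intro hull_minimal) auto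
  show "closed_subalgebra_gen S \<subseteq> ?T"
  proof
    fix h assume h: "h \<in> closed_subalgebra_gen S"
    have "\<alpha> \<in> E" if "\<alpha> \<in> Supp h" for \<alpha>
    proof -
      obtain g where g: "g \<in> mps_subalgebra hull S"
        "\<forall>\<beta>. total_degree \<beta> < Suc (total_degree \<alpha>) \<longrightarrow> mcoeff g \<beta> = mcoeff h \<beta>"
        using h unfolding closed_subalgebra_gen_def mem_closure_iff_approx by meson
      have "mcoeff g \<alpha> = mcoeff h \<alpha>" using g(2) by simp
      then have "\<alpha> \<in> Supp g" using that by (simp add: Supp_def)
      then show "\<alpha> \<in> E" using g(1) hull_sub by blast
    qed
    then show "h \<in> ?T" by blast
  qed
  show "?T \<subseteq> closed_subalgebra_gen S"
  proof
    fix h assume h: "h \<in> ?T"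
    have sub: "mps.subspace (mps_subalgebra hull S)"
      by (intro subspace_of_mps_subalgebra mps_subalgebra_hull)
    have mono: "mmonom 1 \<alpha> \<in> mps_subalgebra hull S" if \<alpha>: "\<alpha> \<in> E" for \<alpha>
    proof -
      obtain c where c: "c \<noteq> 0" "mmonom c \<alpha> \<in> S" using S_mono[OF \<alpha>] by blast
      have "mmonom 1 \<alpha> = mscale (1 / c) (mmonom c \<alpha>)"
        using c(1) by (intro mps_eqI) (simp add: mcoeff_simps)
      moreover have "mscale (1 / c) (mmonom c \<alpha>) \<in> mps_subalgebra hull S"
        using sub c(2) by (intro mps.subspace_scale hull_inc)
      ultimately show ?thesis by simp
    qed
    show "h \<in> closed_subalgebra_gen S"
      unfolding closed_subalgebra_gen_def mem_closure_iff_approx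
    proof
      fix N
      define X where "X = {\<alpha> \<in> E. total_degree \<alpha> \<le> N}"
      have "finite X"
        unfolding X_def by (rule finite_subset[OF _ finite_total_degree_le]) auto
      let ?g = "\<Sum>\<alpha>\<in>X. mscale (mcoeff h \<alpha>) (mmonom 1 \<alpha>)"
      have "?g \<in> mps_subalgebra hull S"
        by (intro mps.subspace_sum mps.subspace_scale sub mono) (simp add: X_def)
      moreover have "mcoeff ?g \<alpha> = mcoeff h \<alpha>" if "total_degree \<alpha> < N" for \<alpha>
        using that h unfolding mcoeff_sum_monomials[OF \<open>finite X\<close>] by (auto simp: X_def Supp_def)
      ultimately show "\<exists>g\<in>mps_subalgebra hull S.
          \<forall>\<alpha>. total_degree \<alpha> < N \<longrightarrow> mcoeff g \<alpha> = mcoeff h \<alpha>"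
        by blast
    qed
  qed
qed

section \<open>Monomials independent modulo a subspace\<close>

text \<open>
  The hypothesis on \<open>X\<close> makes the monomials with exponents in \<open>X\<close> linearly independent modulo
  \<open>V\<close>. Replacing each of them by a representative in the span of \<open>B\<close> keeps them independent, so
  there are at most \<open>card B\<close> of them.
\<close>

lemma finite_of_independent_modulo:
  fixes V :: "('k::field, 'n::finite) mps set"
  assumes V: "mps.subspace V" and "finite B"
    and span: "\<And>g. \<exists>b\<in>mps.span B. g - b \<in> V"
    and indep: "\<And>g. g \<in> V \<Longrightarrow> Supp g \<subseteq> X \<Longrightarrow> g = 0"
  shows "finite X"
proof (rule ccontr)
  assume "infinite X"
  then obtain Y where Y: "Y \<subseteq> X" "finite Y" "card Y = Suc (card B)"
    using infinite_arbitrarily_large by blast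
  have comb: "\<forall>\<alpha>\<in>Y. d \<alpha> = 0" if "(\<Sum>\<alpha>\<in>Y. mscale (d \<alpha>) (mmonom 1 \<alpha>)) \<in> V" for d
  proof -
    note coeff = mcoeff_sum_monomials[OF \<open>finite Y\<close>, of d]
    have "Supp (\<Sum>\<alpha>\<in>Y. mscale (d \<alpha>) (mmonom 1 \<alpha>)) \<subseteq> X"
      using Y(1) by (auto simp: Supp_def coeff)
    from indep[OF that this] have "mcoeff (\<Sum>\<alpha>\<in>Y. mscale (d \<alpha>) (mmonom 1 \<alpha>)) \<beta> = 0" for \<beta>
      by (simp add: mcoeff_simps)
    then show ?thesis unfolding coeff by (metis (full_types))
  qed
  have "\<forall>\<alpha>. \<exists>b. b \<in> mps.span B \<and> mmonom 1 \<alpha> - b \<in> V"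
    using span by blast
  then obtain p where p: "\<And>\<alpha>. p \<alpha> \<in> mps.span B" "\<And>\<alpha>. mmonom 1 \<alpha> - p \<alpha> \<in> V"
    by metis
  have "d \<alpha> = 0" if "(\<Sum>\<alpha>\<in>Y. mscale (d \<alpha>) (p \<alpha>)) = 0" "\<alpha> \<in> Y" for d \<alpha>
  proof -
    have "(\<Sum>\<alpha>\<in>Y. mscale (d \<alpha>) (mmonom 1 \<alpha> - p \<alpha>)) \<in> V"
      by (intro mps.subspace_sum mps.subspace_scale V p)
    with that have "(\<Sum>\<alpha>\<in>Y. mscale (d \<alpha>) (mmonom 1 \<alpha>)) \<in> V"
      by (simp add: mps.scale_right_diff_distrib sum_subtractf)
    with comb that(2) show ?thesis by blast
  qed
  note indep_p = this
  have inj: "inj_on p Y"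
  proof (rule inj_onI, rule ccontr)
    fix \<alpha> \<beta> assume \<alpha>\<beta>: "\<alpha> \<in> Y" "\<beta> \<in> Y" "p \<alpha> = p \<beta>" "\<alpha> \<noteq> \<beta>"
    let ?d = "\<lambda>\<gamma>. if \<gamma> = \<alpha> then 1 else if \<gamma> = \<beta> then - 1 else 0 :: 'k"
    have "(\<Sum>\<gamma>\<in>Y. mscale (?d \<gamma>) (p \<gamma>)) = (\<Sum>\<gamma>\<in>{\<alpha>, \<beta>}. mscale (?d \<gamma>) (p \<gamma>))"
      using \<alpha>\<beta> Y(2) by (intro sum.mono_neutral_right) auto
    also have "\<dots> = 0" using \<alpha>\<beta> by simp
    finally show False using indep_p[of ?d \<alpha>] \<alpha>\<beta>(1) by simp
  qed
  have "mps.independent (p ` Y)"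
  proof (rule mps.independent_if_scalars_zero)
    fix u g
    assume "(\<Sum>x\<in>p ` Y. mscale (u x) x) = 0" and "g \<in> p ` Y"
    then show "u g = 0"
      using indep_p[of "u \<circ> p"] by (auto simp: sum.reindex[OF inj])
  qed (use Y in simp)
  then have "card (p ` Y) \<le> card B"
    using mps.independent_span_bound[OF \<open>finite B\<close>] p(1) by blast
  with Y(3) show False by (simp add: card_image[OF inj])
qed

lemma quotient_rank_finite_iff:
  "quotient_rank V < \<infinity> \<longleftrightarrow> (\<exists>B. quotient_basis V B)"
proof
  assume "quotient_rank V < \<infinity>"
  then have "{enat (card B) | B. quotient_basis V B} \<noteq> {}"
    unfolding quotient_rank_def by (metis Inf_empty less_irrefl top_enat_def)
  then show "\<exists>B. quotient_basis V B" by blast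
next
  assume "\<exists>B. quotient_basis V B"
  then obtain B where "quotient_basis V B" ..
  then have "quotient_rank V \<le> enat (card B)"
    unfolding quotient_rank_def by (intro Inf_lower) blast
  then show "quotient_rank V < \<infinity>" by (rule le_less_trans) simp
qed

lemma quotient_rank_supported_finite_iff:
  fixes E :: "(nat ^ 'n::finite) set"
  shows "quotient_rank {g :: ('k::field, 'n) mps. Supp g \<subseteq> E} < \<infinity> \<longleftrightarrow> finite (- E)"
proof
  let ?V = "{g :: ('k, 'n) mps. Supp g \<subseteq> E}"
  have V: "mps.subspace ?V"
    by (auto simp: mps.subspace_def Supp_def mcoeff_simps subset_iff) (metis add.left_neutral)
  assume "quotient_rank ?V < \<infinity>"
  then obtain B where B: "quotient_basis ?V B" unfolding quotient_rank_finite_iff ..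
  show "finite (- E)"
  proof (rule finite_of_independent_modulo[OF V])
    show "finite B" using B by (simp add: quotient_basis_def)
  next
    fix g
    obtain c where "g - (\<Sum>b\<in>B. mscale (c b) b) \<in> ?V"
      using B unfolding quotient_basis_def by blast
    moreover have "(\<Sum>b\<in>B. mscale (c b) b) \<in> mps.span B"
      by (intro mps.span_sum mps.span_scale mps.span_base)
    ultimately show "\<exists>b\<in>mps.span B. g - b \<in> ?V" by blast
  next
    fix g assume "g \<in> ?V" "Supp g \<subseteq> - E"
    then have "Supp g = {}" by blast
    then show "g = 0" by (intro mps_eqI) (auto simp: Supp_def mcoeff_simps)
  qed
next
  let ?V = "{g :: ('k, 'n) mps. Supp g \<subseteq> E}"
  assume fin: "finite (- E)"
  define m :: "nat ^ 'n \<Rightarrow> ('k, 'n) mps" where "m = mmonom 1"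
  have inj: "inj m"
  proof (rule injI)
    fix \<alpha> \<beta> assume "m \<alpha> = m \<beta>"
    then have "mcoeff (m \<alpha>) \<alpha> = mcoeff (m \<beta>) \<alpha>" by simp
    then show "\<alpha> = \<beta>" by (simp add: m_def mcoeff_simps split: if_splits)
  qed
  have coeff: "mcoeff (\<Sum>b\<in>m ` (- E). mscale (c b) b) \<beta> = (if \<beta> \<in> - E then c (m \<beta>) else 0)" for c \<beta>
  proof -
    have "(\<Sum>b\<in>m ` (- E). mscale (c b) b) = (\<Sum>\<alpha>\<in>- E. mscale (c (m \<alpha>)) (mmonom 1 \<alpha>))"
      by (simp add: sum.reindex[OF inj_on_subset[OF inj subset_UNIV]]) (simp add: m_def)
    then show ?thesis by (simp only: mcoeff_sum_monomials[OF fin])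
  qed
  have "quotient_basis ?V (m ` (- E))"
    unfolding quotient_basis_def
  proof (intro conjI allI impI ballI)
    show "finite (m ` (- E))" using fin by simp
  next
    fix c b
    assume in_V: "(\<Sum>b\<in>m ` (- E). mscale (c b) b) \<in> ?V" and "b \<in> m ` (- E)"
    then obtain \<beta> where \<beta>: "\<beta> \<in> - E" "b = m \<beta>" by blast
    then have "\<beta> \<notin> Supp (\<Sum>b\<in>m ` (- E). mscale (c b) b)" using in_V by blast
    with \<beta> show "c b = 0" by (simp add: Supp_def coeff)
  next
    fix g
    show "\<exists>c. g - (\<Sum>b\<in>m ` (- E). mscale (c b) b) \<in> ?V"
      by (intro exI[of _ "\<lambda>b. mcoeff g (inv m b)"])
        (auto simp: Supp_def mcoeff_simps(4) coeff inv_f_f[OF inj])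
  qed
  then show "quotient_rank ?V < \<infinity>" unfolding quotient_rank_finite_iff by blast
qed

section \<open>The local order attached to a weight\<close>

locale weighted_order =
  fixes r :: "(nat ^ 'n::finite) rel" and a :: "real ^ 'n"
  assumes compatible: "compatible_well_order r" and weight: "a \<in> weights"
begin

text \<open>
  The given well-ordering is reversed here because \<open>exp(f, a)\<close> is a minimum for the weighted
  degree but a maximum for \<open>r\<close>; with the reversal it is the least exponent of \<open>f\<close>.
\<close>

definition less_wt :: "nat ^ 'n \<Rightarrow> nat ^ 'n \<Rightarrow> bool"  (infix "\<lhd>" 50) where
  "\<alpha> \<lhd> \<beta> \<longleftrightarrow> wdeg a \<alpha> < wdeg a \<beta> \<or> wdeg a \<alpha> = wdeg a \<beta> \<and> (\<beta>, \<alpha>) \<in> r \<and> \<alpha> \<noteq> \<beta>"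

lemma r_total: "(\<alpha>, \<beta>) \<in> r \<or> (\<beta>, \<alpha>) \<in> r"
  and r_antisym: "(\<alpha>, \<beta>) \<in> r \<Longrightarrow> (\<beta>, \<alpha>) \<in> r \<Longrightarrow> \<alpha> = \<beta>"
  and r_trans: "(\<alpha>, \<beta>) \<in> r \<Longrightarrow> (\<beta>, \<gamma>) \<in> r \<Longrightarrow> (\<alpha>, \<gamma>) \<in> r"
  and r_add: "(\<alpha>, \<beta>) \<in> r \<Longrightarrow> (\<alpha> + \<gamma>, \<beta> + \<gamma>) \<in> r"
proof -
  have wo: "well_order r" using compatible by (simp add: compatible_well_order_def)
  then have lin: "refl r" "total r" "antisym r" "trans r"
    by (simp_all add: well_order_on_def linear_order_on_def partial_order_on_def preorder_on_def)
  show "(\<alpha>, \<beta>) \<in> r \<or> (\<beta>, \<alpha>) \<in> r"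
    using lin(1,2) unfolding total_on_def refl_on_def by (cases "\<alpha> = \<beta>") auto
  show "(\<alpha>, \<beta>) \<in> r \<Longrightarrow> (\<beta>, \<alpha>) \<in> r \<Longrightarrow> \<alpha> = \<beta>"
    using lin(3) by (rule antisymD)
  show "(\<alpha>, \<beta>) \<in> r \<Longrightarrow> (\<beta>, \<gamma>) \<in> r \<Longrightarrow> (\<alpha>, \<gamma>) \<in> r"
    using lin(4) by (rule transD)
  show "(\<alpha>, \<beta>) \<in> r \<Longrightarrow> (\<alpha> + \<gamma>, \<beta> + \<gamma>) \<in> r"
    using compatible by (simp add: compatible_well_order_def)
qed

lemma less_wt_irrefl: "\<not> \<alpha> \<lhd> \<alpha>"
  by (simp add: less_wt_def)

lemma less_wt_total: "\<alpha> \<lhd> \<beta> \<or> \<alpha> = \<beta> \<or> \<beta> \<lhd> \<alpha>"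
  using r_total[of \<alpha> \<beta>] by (auto simp: less_wt_def)

lemma less_wt_trans: "\<alpha> \<lhd> \<beta> \<Longrightarrow> \<beta> \<lhd> \<gamma> \<Longrightarrow> \<alpha> \<lhd> \<gamma>"
  using r_trans[of \<gamma> \<beta> \<alpha>] r_antisym[of \<alpha> \<beta>] by (auto simp: less_wt_def)

lemma less_wt_add: "\<alpha> \<lhd> \<beta> \<Longrightarrow> \<alpha> + \<gamma> \<lhd> \<beta> + \<gamma>"
  using r_add[of \<beta> \<alpha> \<gamma>] by (auto simp: less_wt_def wdeg_add)

lemma finite_predecessors: "finite {\<alpha>. \<alpha> \<lhd> \<beta>}"
  by (rule finite_subset[OF _ finite_wdeg_le[OF weight, of "wdeg a \<beta>"]]) (auto simp: less_wt_def)

lemma wf_less_wt: "wf {(\<alpha>, \<beta>). \<alpha> \<lhd> \<beta>}"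
proof (rule wf_subset[OF wf_inv_image[OF wf_less_than]])
  show "{(\<alpha>, \<beta>). \<alpha> \<lhd> \<beta>} \<subseteq> inv_image less_than (\<lambda>\<beta>. card {\<alpha>. \<alpha> \<lhd> \<beta>})"
  proof safe
    fix \<alpha> \<beta> assume "\<alpha> \<lhd> \<beta>"
    then have "{\<gamma>. \<gamma> \<lhd> \<alpha>} \<subset> {\<gamma>. \<gamma> \<lhd> \<beta>}"
      using less_wt_trans less_wt_irrefl by blast
    then have "card {\<gamma>. \<gamma> \<lhd> \<alpha>} < card {\<gamma>. \<gamma> \<lhd> \<beta>}"
      by (rule psubset_card_mono[OF finite_predecessors])
    then show "(\<alpha>, \<beta>) \<in> inv_image less_than (\<lambda>\<beta>. card {\<alpha>. \<alpha> \<lhd> \<beta>})"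
      by (simp add: in_inv_image)
  qed
qed

lemma exists_least:
  assumes "X \<noteq> {}"
  shows "\<exists>\<mu>\<in>X. \<forall>\<beta>\<in>X. \<beta> = \<mu> \<or> \<mu> \<lhd> \<beta>"
proof -
  obtain \<alpha> where "\<alpha> \<in> X" using assms by blast
  then obtain \<mu> where "\<mu> \<in> X" "\<And>\<beta>. (\<beta>, \<mu>) \<in> {(\<alpha>, \<beta>). \<alpha> \<lhd> \<beta>} \<Longrightarrow> \<beta> \<notin> X"
    using wfE_min[OF wf_less_wt] by metis
  then show ?thesis using less_wt_total by blast
qed

lemma lead_exp_eqI:
  fixes f :: "('k::field, 'n) mps"
  assumes \<mu>: "\<mu> \<in> Supp f" and least: "\<And>\<beta>. \<beta> \<in> Supp f \<Longrightarrow> \<beta> = \<mu> \<or> \<mu> \<lhd> \<beta>"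
  shows "lead_exp r f a = \<mu>"
proof -
  have "ord_wt f a = wdeg a \<mu>"
    unfolding ord_wt_def
    by (rule Least_equality) (use \<mu> least in \<open>fastforce simp: less_wt_def\<close>)+
  then have supp: "Supp (init_form f a) = {\<beta> \<in> Supp f. wdeg a \<beta> = wdeg a \<mu>}"
    by (auto simp: Supp_def init_form_def Mps_inverse)
  have max: "(\<beta>, \<mu>) \<in> r" if "\<beta> \<in> Supp (init_form f a)" for \<beta>
    using that least[of \<beta>] r_total[of \<mu> \<mu>] unfolding supp by (auto simp: less_wt_def)
  have "\<mu> \<in> Supp (init_form f a)" using \<mu> by (simp add: supp)
  with max show ?thesis
    unfolding lead_exp_def by (intro the_equality) (auto intro: r_antisym)
qed

lemma lead_exp_least:
  fixes f :: "('k::field, 'n) mps"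
  assumes "f \<noteq> 0"
  shows "lead_exp r f a \<in> Supp f"
    and "\<And>\<beta>. \<beta> \<in> Supp f \<Longrightarrow> \<beta> = lead_exp r f a \<or> lead_exp r f a \<lhd> \<beta>"
proof -
  have "Supp f \<noteq> {}"
    using assms by (auto simp: Supp_def mcoeff_simps intro: mps_eqI)
  then obtain \<mu> where \<mu>: "\<mu> \<in> Supp f" "\<forall>\<beta>\<in>Supp f. \<beta> = \<mu> \<or> \<mu> \<lhd> \<beta>"
    using exists_least by blast
  moreover from \<mu> have "lead_exp r f a = \<mu>" by (intro lead_exp_eqI) auto
  ultimately show "lead_exp r f a \<in> Supp f"
    "\<And>\<beta>. \<beta> \<in> Supp f \<Longrightarrow> \<beta> = lead_exp r f a \<or> lead_exp r f a \<lhd> \<beta>" by auto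
qed

lemma lead_exp_mult:
  fixes f g :: "('k::field, 'n) mps"
  assumes f: "f \<noteq> 0" and g: "g \<noteq> 0"
  shows "f * g \<noteq> 0" and "lead_exp r (f * g) a = lead_exp r f a + lead_exp r g a"
proof -
  define \<mu> where "\<mu> = lead_exp r f a"
  define \<nu> where "\<nu> = lead_exp r g a"
  note \<mu> = lead_exp_least[OF f, folded \<mu>_def] and \<nu> = lead_exp_least[OF g, folded \<nu>_def]
  have later: "\<alpha> = \<mu> \<and> \<beta> = \<nu> \<or> \<mu> + \<nu> \<lhd> \<alpha> + \<beta>" if "\<alpha> \<in> Supp f" "\<beta> \<in> Supp g" for \<alpha> \<beta>
    using \<mu>(2)[OF that(1)] \<nu>(2)[OF that(2)] less_wt_add[of \<mu> \<alpha> \<nu>] less_wt_add[of \<nu> \<beta> \<alpha>]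
    by (auto simp: add.commute intro: less_wt_trans)
  \<comment> \<open>The coefficient at the sum of the two leading exponents has only one nonzero contribution.\<close>
  have "mcoeff (f * g) (\<mu> + \<nu>) = (\<Sum>(\<alpha>, \<beta>)\<in>{(\<mu>, \<nu>)}. mcoeff f \<alpha> * mcoeff g \<beta>)"
    unfolding times_mps.rep_eq
  proof (rule sum.mono_neutral_right)
    show "\<forall>p\<in>{(\<alpha>, \<beta>). \<alpha> + \<beta> = \<mu> + \<nu>} - {(\<mu>, \<nu>)}.
        (case p of (\<alpha>, \<beta>) \<Rightarrow> mcoeff f \<alpha> * mcoeff g \<beta>) = 0"
    proof
      fix p assume p: "p \<in> {(\<alpha>, \<beta>). \<alpha> + \<beta> = \<mu> + \<nu>} - {(\<mu>, \<nu>)}"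
      obtain \<alpha> \<beta> where "p = (\<alpha>, \<beta>)" by (cases p)
      with p show "(case p of (\<alpha>, \<beta>) \<Rightarrow> mcoeff f \<alpha> * mcoeff g \<beta>) = 0"
        using later[of \<alpha> \<beta>] less_wt_irrefl[of "\<mu> + \<nu>"] by (auto simp: Supp_def)
    qed
  qed (auto simp: finite_antidiagonal)
  then have mem: "\<mu> + \<nu> \<in> Supp (f * g)"
    using \<mu>(1) \<nu>(1) by (simp add: Supp_def)
  then show "f * g \<noteq> 0" by (auto simp: Supp_def mcoeff_simps)
  have "lead_exp r (f * g) a = \<mu> + \<nu>"
  proof (rule lead_exp_eqI[OF mem])
    fix \<gamma> assume "\<gamma> \<in> Supp (f * g)"
    then show "\<gamma> = \<mu> + \<nu> \<or> \<mu> + \<nu> \<lhd> \<gamma>" using Supp_mult later by blast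
  qed
  then show "lead_exp r (f * g) a = lead_exp r f a + lead_exp r g a"
    by (simp only: \<mu>_def \<nu>_def)
qed

section \<open>Leading exponents and codimension\<close>

lemma submonoid_exp_set:
  fixes A :: "('k::field, 'n) mps set"
  assumes A: "mps_subalgebra A"
  shows "submonoid (exp_set r A a)"
  unfolding submonoid_def
proof (intro conjI ballI)
  have "lead_exp r (1 :: ('k, 'n) mps) a = 0"
    by (rule lead_exp_eqI) (auto simp: Supp_def mcoeff_simps split: if_splits)
  moreover have "(1 :: ('k, 'n) mps) \<in> A - {0}"
    using A by (simp add: mps_subalgebra_def)
  ultimately show "0 \<in> exp_set r A a" unfolding exp_set_def by force
next
  fix \<alpha> \<beta> assume "\<alpha> \<in> exp_set r A a" "\<beta> \<in> exp_set r A a"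
  then obtain f g where fg: "f \<in> A" "f \<noteq> 0" "\<alpha> = lead_exp r f a"
    "g \<in> A" "g \<noteq> 0" "\<beta> = lead_exp r g a"
    unfolding exp_set_def by blast
  then have "f * g \<in> A - {0}" using A lead_exp_mult(1)[of f g] by (simp add: mps_subalgebra_def)
  then show "\<alpha> + \<beta> \<in> exp_set r A a"
    unfolding exp_set_def using fg lead_exp_mult(2)[of f g] by force
qed

text \<open>
  Every leading exponent \<open>\<alpha>\<close> comes with a leading monomial that is a nonzero multiple of
  \<open>x\<^sup>\<alpha>\<close>, so the algebra is topologically generated by the monomials with exponents in the monoid.
\<close>

lemma lead_alg_eq:
  fixes A :: "('k::field, 'n) mps set"
  assumes A: "mps_subalgebra A"
  shows "lead_alg r A a = {g. Supp g \<subseteq> exp_set r A a}"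
  unfolding lead_alg_def
proof (rule closed_subalgebra_gen_monomials[OF submonoid_exp_set[OF A]])
  fix g assume "g \<in> {lead_monom r f a | f. f \<in> A - {0}}"
  then show "Supp g \<subseteq> exp_set r A a"
    by (auto simp: lead_monom_def Supp_def mcoeff_simps exp_set_def split: if_splits)
next
  fix \<alpha> assume "\<alpha> \<in> exp_set r A a"
  then obtain f where f: "f \<in> A - {0}" "\<alpha> = lead_exp r f a" unfolding exp_set_def by blast
  then have "mcoeff f \<alpha> \<noteq> 0" using lead_exp_least(1)[of f] by (simp add: Supp_def)
  moreover have "mmonom (mcoeff f \<alpha>) \<alpha> = lead_monom r f a"
    by (simp add: lead_monom_def f(2))
  ultimately show "\<exists>c. c \<noteq> 0 \<and> mmonom c \<alpha> \<in> {lead_monom r f a | f. f \<in> A - {0}}"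
    using f(1) by blast
qed

lemma eq_0_of_Supp_disjoint_exp_set:
  fixes g :: "('k::field, 'n) mps"
  assumes "g \<in> V" "Supp g \<subseteq> - exp_set r V a"
  shows "g = 0"
  using assms lead_exp_least(1)[of g] unfolding exp_set_def by blast

text \<open>
  A family \<open>q\<close> in which \<open>q \<alpha>\<close> starts with \<open>x\<^sup>\<alpha>\<close> is triangular with respect to the order, and
  each exponent has only finitely many predecessors. So the coefficients of an expansion
  \<open>h = \<Sum>\<alpha>. d \<alpha> q \<alpha>\<close> can be found recursively along the order.
\<close>

lemma exists_triangular_expansion:
  fixes h :: "('k::field, 'n) mps" and q :: "nat ^ 'n \<Rightarrow> ('k, 'n) mps"
  assumes unit: "\<And>\<alpha>. mcoeff (q \<alpha>) \<alpha> = 1"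
  shows "\<exists>d. \<forall>\<beta>. mcoeff h \<beta> = (\<Sum>\<alpha> | \<alpha> = \<beta> \<or> \<alpha> \<lhd> \<beta>. d \<alpha> * mcoeff (q \<alpha>) \<beta>)"
proof -
  let ?R = "{(\<alpha>, \<beta>). \<alpha> \<lhd> \<beta>}"
  let ?F = "\<lambda>d \<beta>. mcoeff h \<beta> - (\<Sum>\<alpha> | \<alpha> \<lhd> \<beta>. d \<alpha> * mcoeff (q \<alpha>) \<beta>)"
  define d where "d = wfrec ?R ?F"
  have rec: "d \<beta> = ?F d \<beta>" for \<beta>
    unfolding d_def by (subst wfrec[OF wf_less_wt]) (simp add: cut_def)
  have "mcoeff h \<beta> = (\<Sum>\<alpha> | \<alpha> = \<beta> \<or> \<alpha> \<lhd> \<beta>. d \<alpha> * mcoeff (q \<alpha>) \<beta>)" for \<beta>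
  proof -
    have "{\<alpha>. \<alpha> = \<beta> \<or> \<alpha> \<lhd> \<beta>} = insert \<beta> {\<alpha>. \<alpha> \<lhd> \<beta>}" by auto
    then have "(\<Sum>\<alpha> | \<alpha> = \<beta> \<or> \<alpha> \<lhd> \<beta>. d \<alpha> * mcoeff (q \<alpha>) \<beta>) =
        d \<beta> + (\<Sum>\<alpha> | \<alpha> \<lhd> \<beta>. d \<alpha> * mcoeff (q \<alpha>) \<beta>)"
      by (simp add: finite_predecessors less_wt_irrefl unit)
    then show ?thesis using rec[of \<beta>] by simp
  qed
  then show ?thesis by blast
qed

text \<open>
  Expand the series in the family consisting of an element of \<open>V\<close> with leading exponent \<open>\<alpha>\<close>
  for each \<open>\<alpha>\<close> in \<open>exp_set r V a\<close>, and of the monomial \<open>x\<^sup>\<alpha>\<close> for every other \<open>\<alpha>\<close>. The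
  part of the expansion that belongs to the latter is the remainder; the other part is a limit of
  finite linear combinations of elements of \<open>V\<close>.
\<close>

lemma division_by_closed_subspace:
  fixes V :: "('k::field, 'n) mps set"
  assumes V: "mps.subspace V" and "closed V"
  shows "\<exists>h. Supp h \<subseteq> - exp_set r V a \<and> g - h \<in> V"
proof -
  define E where "E = exp_set r V a"
  have "\<exists>p. p \<in> V \<and> mcoeff p \<alpha> = 1 \<and> (\<forall>\<beta>\<in>Supp p. \<beta> = \<alpha> \<or> \<alpha> \<lhd> \<beta>)" if \<alpha>: "\<alpha> \<in> E" for \<alpha>
  proof -
    obtain f where f: "f \<in> V" "f \<noteq> 0" "\<alpha> = lead_exp r f a"
      using \<alpha> unfolding E_def exp_set_def by blast
    let ?p = "mscale (1 / mcoeff f \<alpha>) f"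
    have "?p \<in> V" using V f(1) by (rule mps.subspace_scale)
    moreover have "mcoeff ?p \<alpha> = 1"
      using lead_exp_least(1)[OF f(2)] f(3) by (simp add: mcoeff_simps Supp_def)
    moreover have "\<forall>\<beta>\<in>Supp ?p. \<beta> = \<alpha> \<or> \<alpha> \<lhd> \<beta>"
      using lead_exp_least(2)[OF f(2)] f(3) by (auto simp: mcoeff_simps Supp_def)
    ultimately show ?thesis by blast
  qed
  then obtain p where p: "\<And>\<alpha>. \<alpha> \<in> E \<Longrightarrow> p \<alpha> \<in> V" "\<And>\<alpha>. \<alpha> \<in> E \<Longrightarrow> mcoeff (p \<alpha>) \<alpha> = 1"
    "\<And>\<alpha> \<beta>. \<alpha> \<in> E \<Longrightarrow> \<beta> \<in> Supp (p \<alpha>) \<Longrightarrow> \<beta> = \<alpha> \<or> \<alpha> \<lhd> \<beta>"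
    by metis
  define q where "q \<alpha> = (if \<alpha> \<in> E then p \<alpha> else mmonom 1 \<alpha>)" for \<alpha>
  define D where "D \<beta> = {\<alpha>. \<alpha> = \<beta> \<or> \<alpha> \<lhd> \<beta>}" for \<beta>
  have finite_D: "finite (D \<beta>)" for \<beta>
    using finite_predecessors[of \<beta>] by (simp add: D_def)
  have unit: "mcoeff (q \<alpha>) \<alpha> = 1" for \<alpha>
    using p(2) by (simp add: q_def mcoeff_simps)
  obtain d where d: "\<And>\<beta>. mcoeff g \<beta> = (\<Sum>\<alpha>\<in>D \<beta>. d \<alpha> * mcoeff (q \<alpha>) \<beta>)"
    using exists_triangular_expansion[of q g, OF unit] unfolding D_def by blast
  define h :: "('k, 'n) mps" where "h = Mps (\<lambda>\<beta>. if \<beta> \<in> E then 0 else d \<beta>)"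
  have "Supp h \<subseteq> - E" by (auto simp: Supp_def h_def Mps_inverse)
  have quotient: "mcoeff (g - h) \<beta> = (\<Sum>\<alpha>\<in>D \<beta> \<inter> E. d \<alpha> * mcoeff (p \<alpha>) \<beta>)" for \<beta>
  proof -
    have "mcoeff g \<beta> = (\<Sum>\<alpha>\<in>D \<beta>. if \<alpha> \<in> E then d \<alpha> * mcoeff (p \<alpha>) \<beta>
        else if \<beta> = \<alpha> then d \<alpha> else 0)"
      unfolding d by (rule sum.cong) (auto simp: q_def mcoeff_simps)
    also have "\<dots> = (\<Sum>\<alpha>\<in>D \<beta> \<inter> E. d \<alpha> * mcoeff (p \<alpha>) \<beta>)
        + (\<Sum>\<alpha>\<in>D \<beta> \<inter> - E. if \<beta> = \<alpha> then d \<alpha> else 0)"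
      by (subst sum.If_cases[OF finite_D]) simp
    also have "(\<Sum>\<alpha>\<in>D \<beta> \<inter> - E. if \<beta> = \<alpha> then d \<alpha> else 0) = mcoeff h \<beta>"
      using finite_D[of \<beta>] by (simp add: h_def Mps_inverse D_def)
    finally show ?thesis by (simp add: minus_mps.rep_eq)
  qed
  have "g - h \<in> closure V"
    unfolding mem_closure_iff_approx
  proof
    fix N
    define X where "X = (\<Union>\<beta>\<in>{\<beta>. total_degree \<beta> \<le> N}. D \<beta> \<inter> E)"
    have "finite X"
      unfolding X_def using finite_total_degree_le finite_D by blast
    let ?v = "\<Sum>\<alpha>\<in>X. mscale (d \<alpha>) (p \<alpha>)"
    have "?v \<in> V"
      by (intro mps.subspace_sum mps.subspace_scale V p(1)) (auto simp: X_def)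
    moreover have "mcoeff ?v \<beta> = mcoeff (g - h) \<beta>" if "total_degree \<beta> < N" for \<beta>
    proof -
      have "mcoeff ?v \<beta> = (\<Sum>\<alpha>\<in>X. d \<alpha> * mcoeff (p \<alpha>) \<beta>)"
        by (simp add: mcoeff_simps)
      also have "\<dots> = (\<Sum>\<alpha>\<in>D \<beta> \<inter> E. d \<alpha> * mcoeff (p \<alpha>) \<beta>)"
      proof (rule sum.mono_neutral_right[OF \<open>finite X\<close>])
        show "D \<beta> \<inter> E \<subseteq> X" using that unfolding X_def by (auto intro: less_imp_le)
        show "\<forall>\<alpha>\<in>X - D \<beta> \<inter> E. d \<alpha> * mcoeff (p \<alpha>) \<beta> = 0"
        proof
          fix \<alpha> assume \<alpha>: "\<alpha> \<in> X - D \<beta> \<inter> E"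
          then have "\<alpha> \<in> E" "\<alpha> \<notin> D \<beta>" by (auto simp: X_def)
          then have "\<beta> \<notin> Supp (p \<alpha>)" using p(3)[of \<alpha> \<beta>] by (auto simp: D_def)
          then show "d \<alpha> * mcoeff (p \<alpha>) \<beta> = 0" by (simp add: Supp_def)
        qed
      qed
      finally show ?thesis by (simp only: quotient)
    qed
    ultimately show "\<exists>v\<in>V. \<forall>\<alpha>. total_degree \<alpha> < N \<longrightarrow> mcoeff v \<alpha> = mcoeff (g - h) \<alpha>"
      by blast
  qed
  with \<open>closed V\<close> \<open>Supp h \<subseteq> - E\<close> show ?thesis unfolding E_def by auto
qed

lemma spanning_monomials_modulo:
  fixes V :: "('k::field, 'n) mps set"
  assumes "mps.subspace V" "closed V" and fin: "finite (- exp_set r V a)"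
  shows "\<exists>b\<in>mps.span (mmonom 1 ` (- exp_set r V a)). g - b \<in> V"
proof -
  obtain h where h: "Supp h \<subseteq> - exp_set r V a" "g - h \<in> V"
    using division_by_closed_subspace assms(1,2) by blast
  have "h = (\<Sum>\<alpha>\<in>- exp_set r V a. mscale (mcoeff h \<alpha>) (mmonom 1 \<alpha>))"
    using h(1) by (intro mps_eqI) (auto simp: mcoeff_sum_monomials[OF fin] Supp_def)
  also have "\<dots> \<in> mps.span (mmonom 1 ` (- exp_set r V a))"
    by (intro mps.span_sum mps.span_scale mps.span_base) simp
  finally show ?thesis using h(2) by blast
qed

end

section \<open>Independence of the weight\<close>

lemma exp_set_cofinite_transfer:
  fixes V :: "('k::field, 'n::finite) mps set"
  assumes "compatible_well_order r" and "a0 \<in> weights" "a \<in> weights"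
    and V: "mps.subspace V" "closed V" and fin: "finite (- exp_set r V a0)"
  shows "finite (- exp_set r V a)"
proof -
  interpret a0: weighted_order r a0 using assms by unfold_locales
  interpret a: weighted_order r a using assms by unfold_locales
  show ?thesis
  proof (rule finite_of_independent_modulo[OF V(1)])
    show "finite (mmonom 1 ` (- exp_set r V a0))" using fin by simp
    show "\<exists>b\<in>mps.span (mmonom 1 ` (- exp_set r V a0)). g - b \<in> V" for g
      using a0.spanning_monomials_modulo[OF V fin] .
    show "g = 0" if "g \<in> V" "Supp g \<subseteq> - exp_set r V a" for g
      using a.eq_0_of_Supp_disjoint_exp_set[OF that] .
  qed
qed

theorem proposition16:
  fixes r :: "(nat ^ 'n::finite) rel"
    and f :: "nat \<Rightarrow> ('k::field, 'n) mps"
    and s :: nat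
    and A :: "('k, 'n) mps set"
  assumes "compatible_well_order r"
    and "\<And>i. i \<in> {1..s} \<Longrightarrow> f i \<noteq> 0"
    and "A = closed_subalgebra_gen (f ` {1..s})"
    and "\<exists>a0 \<in> weights. quotient_rank (lead_alg r A a0) < \<infinity>"
  shows "(\<forall>a \<in> weights. quotient_rank (lead_alg r A a) < \<infinity>) \<and>
         (\<forall>a \<in> weights. finitely_generated (exp_set r A a))"
proof -
  have A: "mps_subalgebra A" "closed A"
    unfolding assms(3) by (rule mps_subalgebra_closed_subalgebra_gen)
      (simp add: closed_subalgebra_gen_def)
  have rank_iff: "quotient_rank (lead_alg r A a) < \<infinity> \<longleftrightarrow> finite (- exp_set r A a)"
    and monoid: "submonoid (exp_set r A a)" if "a \<in> weights" for a
  proof -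
    interpret weighted_order r a using assms(1) that by unfold_locales
    show "quotient_rank (lead_alg r A a) < \<infinity> \<longleftrightarrow> finite (- exp_set r A a)"
      unfolding lead_alg_eq[OF A(1)] by (rule quotient_rank_supported_finite_iff)
    show "submonoid (exp_set r A a)" by (rule submonoid_exp_set[OF A(1)])
  qed
  obtain a0 where "a0 \<in> weights" "finite (- exp_set r A a0)"
    using assms(4) rank_iff by blast
  then have cofinite: "finite (- exp_set r A a)" if "a \<in> weights" for a
    using exp_set_cofinite_transfer[OF assms(1)] that A subspace_of_mps_subalgebra by blast
  with rank_iff monoid cofinite_submonoid_finitely_generated show ?thesis by blast
qed

end
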